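(* Let $\mathcal{F}$ be a finite signature, $\mathcal{A}$ a weakly monotone well-founded ordered $\mathcal{F}$-algebra that is moreover simple, and $\succsim$ a precedence on $\mathcal{F}$. Then the weighted path order $>_\mathsf{wpo}$, the semantic path order $>_\mathsf{spo}$ and the monotonic semantic path order $>_\mathsf{mspo}$ induced from $\mathcal{A}$ and $\succsim$ (as defined below) coincide as relations on $\mathcal{T}(\mathcal{F},\mathcal{V})$.
   Context: A precedence is a quasi-order $\succsim$ on $\mathcal{F}$ with strict part $\succ$. An ordered $\mathcal{F}$-algebra $\mathcal{A}=(A,\{f_\mathcal{A}\},>)$ has a carrier $A$, a strict order $>$ on $A$ (with reflexive closure $\geqslant$), and functions $f_\mathcal{A}:A^n\to A$ for $n$-ary $f$. $s >_\mathcal{A} t$ (resp. $s\geqslant_\mathcal{A} t$) means $[\alpha]_\mathcal{A}(s) > [\alpha]_\mathcal{A}(t)$ (resp. $\geqslant$) for every assignment $\alpha:\mathcal{V}\to A$. $\mathcal{A}$ is simple if $f_\mathcal{A}(a_1,\dots,a_n)\geqslant a_i$ for all $f$, $i$, $a_1,\dots,a_n$; weakly monotone if $f_\mathcal{A}(a_1,\dots,a_i,\dots,a_n)\geqslant f_\mathcal{A}(a_1,\dots,b,\dots,a_n)$ whenever $a_i > b$; well-founded if $>$ is well-founded. Lexicographic extension: $(s_1,\dots,s_m) >^{\mathrm{lex}*} (t_1,\dots,t_n)$ iff either there is $k\le\min(m,n)$ with $s_i=t_i$ for $i<k$ and $s_k>t_k$, or $m>n$ and $s_i=t_i$ for all $i\le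 n$. WPO: $s >_\mathsf{wpo} t$ iff (1) $s >_\mathcal{A} t$, or (2) $s\geqslant_\mathcal{A} t$, $s=f(s_1,\dots,s_m)$, and either (a) $s_i\geqslant_\mathsf{wpo} t$ for some $i$, or (b) $t=g(t_1,\dots,t_n)$, $s>_\mathsf{wpo} t_j$ for all $j$, and (i) $f\succ g$ or (ii) $f\succsim g$ and $(s_1,\dots,s_m) >_\mathsf{wpo}^{\mathrm{lex}*}(t_1,\dots,t_n)$; $\geqslant_\mathsf{wpo}$ is the reflexive closure. Relations on non-variable terms: for $s=f(\dots)$, $t=g(\dots)$, $s\mathrel{\sqsupset\!\!\!\sim} t$ iff $s>_\mathcal{A} t$ or ($s\geqslant_\mathcal{A} t$ and $f\succsim g$); $s\sqsupset t$ iff $s>_\mathcal{A} t$ or ($s\geqslant_\mathcal{A} t$ and $f\succ g$). SPO: $s>_\mathsf{spo} t$ iff $s=f(s_1,\dots,s_m)$ and either (1) $s_i\geqslant_\mathsf{spo} t$ for some $i$, or (2) $t=g(t_1,\dots,t_n)$, $s>_\mathsf{spo} t_j$ for all $j$, and (a) $s\sqsupset t$, or (b) $s\mathrel{\sqsupset\!\!\!\sim} t$ and $(s_1,\dots,s_m)>_\mathsf{spo}^{\mathrm{lex}*}(t_1,\dots,t_n)$; $\geqslant_\mathsf{spo}$ is the reflexive closure. MSPO: $s>_\mathsf{mspo} t$ iff $s\geqslant_\mathcal{A} t$ and $s>_\mathsf{spo} t$. *)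

theory Defs
  imports Main
begin

datatype ('f, 'v) trm = Var 'v | Fun 'f "('f, 'v) trm list"

text \<open>The set \<open>T(F, V)\<close>, where \<open>V\<close> is all of the type \<open>'v\<close> and \<open>ar\<close> gives the arities.\<close>

inductive_set terms_over :: "'f set \<Rightarrow> ('f \<Rightarrow> nat) \<Rightarrow> ('f, 'v) trm set"
  for F :: "'f set" and ar :: "'f \<Rightarrow> nat" where
  Var: "Var x \<in> terms_over F ar"
| Fun: "f \<in> F \<Longrightarrow> length ts = ar f \<Longrightarrow> (\<And>t. t \<in> set ts \<Longrightarrow> t \<in> terms_over F ar)
    \<Longrightarrow> Fun f ts \<in> terms_over F ar"

definition precedence_on :: "'f set \<Rightarrow> ('f \<Rightarrow> 'f \<Rightarrow> bool) \<Rightarrow> bool" where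
  "precedence_on F prec \<longleftrightarrow> reflp_on F prec \<and> transp_on F prec"

definition strict_part :: "('f \<Rightarrow> 'f \<Rightarrow> bool) \<Rightarrow> 'f \<Rightarrow> 'f \<Rightarrow> bool" where
  "strict_part prec f g \<longleftrightarrow> prec f g \<and> \<not> prec g f"

text \<open>
  An algebra is given by a carrier \<open>A\<close>, an interpretation \<open>I\<close> of the function symbols on argument
  lists and the order \<open>gt\<close>, where \<open>gt a b\<close> stands for \<open>a > b\<close>. The values of \<open>I\<close> and \<open>gt\<close> are
  relevant only on the carrier and on argument lists whose length is the arity. Carriers are
  nonempty: over an empty one, every statement about all assignments would hold vacuously.
\<close>

definition ordered_algebra ::
  "'f set \<Rightarrow> ('f \<Rightarrow> nat) \<Rightarrow> 'a set \<Rightarrow> ('f \<Rightarrow> 'a list \<Rightarrow> 'a) \<Rightarrow> ('a \<Rightarrow> 'a \<Rightarrow> bool) \<Rightarrow> bool" where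
  "ordered_algebra F ar A I gt \<longleftrightarrow>
     A \<noteq> {} \<and>
     (\<forall>f\<in>F. \<forall>as. length as = ar f \<and> set as \<subseteq> A \<longrightarrow> I f as \<in> A) \<and>
     irreflp_on A gt \<and> transp_on A gt"

definition simple_algebra ::
  "'f set \<Rightarrow> ('f \<Rightarrow> nat) \<Rightarrow> 'a set \<Rightarrow> ('f \<Rightarrow> 'a list \<Rightarrow> 'a) \<Rightarrow> ('a \<Rightarrow> 'a \<Rightarrow> bool) \<Rightarrow> bool" where
  "simple_algebra F ar A I gt \<longleftrightarrow>
     (\<forall>f\<in>F. \<forall>as. length as = ar f \<and> set as \<subseteq> A \<longrightarrow>
       (\<forall>i<ar f. gt\<^sup>=\<^sup>= (I f as) (as ! i)))"

definition weakly_monotone_algebra ::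
  "'f set \<Rightarrow> ('f \<Rightarrow> nat) \<Rightarrow> 'a set \<Rightarrow> ('f \<Rightarrow> 'a list \<Rightarrow> 'a) \<Rightarrow> ('a \<Rightarrow> 'a \<Rightarrow> bool) \<Rightarrow> bool" where
  "weakly_monotone_algebra F ar A I gt \<longleftrightarrow>
     (\<forall>f\<in>F. \<forall>as. length as = ar f \<and> set as \<subseteq> A \<longrightarrow>
       (\<forall>i<ar f. \<forall>b\<in>A. gt (as ! i) b \<longrightarrow> gt\<^sup>=\<^sup>= (I f as) (I f (as[i := b]))))"

text \<open>Well-foundedness in \<open>wfp_on\<close> refers to the \<open>less\<close> direction, hence the converse.\<close>

definition well_founded_algebra :: "'a set \<Rightarrow> ('a \<Rightarrow> 'a \<Rightarrow> bool) \<Rightarrow> bool" where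
  "well_founded_algebra A gt \<longleftrightarrow> wfp_on A gt\<inverse>\<inverse>"

primrec eval :: "('f \<Rightarrow> 'a list \<Rightarrow> 'a) \<Rightarrow> ('v \<Rightarrow> 'a) \<Rightarrow> ('f, 'v) trm \<Rightarrow> 'a" where
  "eval I \<alpha> (Var x) = \<alpha> x"
| "eval I \<alpha> (Fun f ts) = I f (map (eval I \<alpha>) ts)"

definition gt_alg ::
  "'a set \<Rightarrow> ('f \<Rightarrow> 'a list \<Rightarrow> 'a) \<Rightarrow> ('a \<Rightarrow> 'a \<Rightarrow> bool) \<Rightarrow> ('f, 'v) trm \<Rightarrow> ('f, 'v) trm \<Rightarrow> bool" where
  "gt_alg A I gt s t \<longleftrightarrow> (\<forall>\<alpha>. range \<alpha> \<subseteq> A \<longrightarrow> gt (eval I \<alpha> s) (eval I \<alpha> t))"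

text \<open>The reflexive closure is taken per assignment; this is not the reflexive closure of
  \<open>gt_alg\<close>.\<close>

definition ge_alg ::
  "'a set \<Rightarrow> ('f \<Rightarrow> 'a list \<Rightarrow> 'a) \<Rightarrow> ('a \<Rightarrow> 'a \<Rightarrow> bool) \<Rightarrow> ('f, 'v) trm \<Rightarrow> ('f, 'v) trm \<Rightarrow> bool" where
  "ge_alg A I gt s t \<longleftrightarrow> (\<forall>\<alpha>. range \<alpha> \<subseteq> A \<longrightarrow> gt\<^sup>=\<^sup>= (eval I \<alpha> s) (eval I \<alpha> t))"

definition lex_ext :: "('b \<Rightarrow> 'b \<Rightarrow> bool) \<Rightarrow> 'b list \<Rightarrow> 'b list \<Rightarrow> bool" where
  "lex_ext R ss ts \<longleftrightarrow>
     (\<exists>k < min (length ss) (length ts). (\<forall>i<k. ss ! i = ts ! i) \<and> R (ss ! k) (ts ! k)) \<or>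
     (length ss > length ts \<and> (\<forall>i<length ts. ss ! i = ts ! i))"

lemma lex_ext_mono [mono]:
  assumes "\<And>x y. R x y \<longrightarrow> S x y"
  shows "lex_ext R ss ts \<longrightarrow> lex_ext S ss ts"
  using assms unfolding lex_ext_def by blast

text \<open>
  All recursive calls in the path orders are on pairs of terms of smaller total size, so the
  recursive description has a unique solution, namely the inductively defined relation.
\<close>

inductive wpo ::
  "'a set \<Rightarrow> ('f \<Rightarrow> 'a list \<Rightarrow> 'a) \<Rightarrow> ('a \<Rightarrow> 'a \<Rightarrow> bool) \<Rightarrow> ('f \<Rightarrow> 'f \<Rightarrow> bool)
    \<Rightarrow> ('f, 'v) trm \<Rightarrow> ('f, 'v) trm \<Rightarrow> bool"
  for A :: "'a set" and I :: "'f \<Rightarrow> 'a list \<Rightarrow> 'a" and gt :: "'a \<Rightarrow> 'a \<Rightarrow> bool"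
    and prec :: "'f \<Rightarrow> 'f \<Rightarrow> bool" where
  alg: "gt_alg A I gt s t \<Longrightarrow> wpo A I gt prec s t"
| arg: "ge_alg A I gt (Fun f ss) t \<Longrightarrow> si \<in> set ss \<Longrightarrow> si = t \<or> wpo A I gt prec si t
    \<Longrightarrow> wpo A I gt prec (Fun f ss) t"
| prec: "ge_alg A I gt (Fun f ss) (Fun g ts)
    \<Longrightarrow> (\<And>tj. tj \<in> set ts \<Longrightarrow> wpo A I gt prec (Fun f ss) tj)
    \<Longrightarrow> strict_part prec f g
    \<Longrightarrow> wpo A I gt prec (Fun f ss) (Fun g ts)"
| lex: "ge_alg A I gt (Fun f ss) (Fun g ts)
    \<Longrightarrow> (\<And>tj. tj \<in> set ts \<Longrightarrow> wpo A I gt prec (Fun f ss) tj)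
    \<Longrightarrow> prec f g \<Longrightarrow> lex_ext (wpo A I gt prec) ss ts
    \<Longrightarrow> wpo A I gt prec (Fun f ss) (Fun g ts)"

text \<open>The two relations on non-variable terms underlying the semantic path order.\<close>

inductive root_ge ::
  "'a set \<Rightarrow> ('f \<Rightarrow> 'a list \<Rightarrow> 'a) \<Rightarrow> ('a \<Rightarrow> 'a \<Rightarrow> bool) \<Rightarrow> ('f \<Rightarrow> 'f \<Rightarrow> bool)
    \<Rightarrow> ('f, 'v) trm \<Rightarrow> ('f, 'v) trm \<Rightarrow> bool"
  for A :: "'a set" and I :: "'f \<Rightarrow> 'a list \<Rightarrow> 'a" and gt :: "'a \<Rightarrow> 'a \<Rightarrow> bool"
    and prec :: "'f \<Rightarrow> 'f \<Rightarrow> bool" where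
  "gt_alg A I gt (Fun f ss) (Fun g ts) \<or> (ge_alg A I gt (Fun f ss) (Fun g ts) \<and> prec f g)
    \<Longrightarrow> root_ge A I gt prec (Fun f ss) (Fun g ts)"

inductive root_gt ::
  "'a set \<Rightarrow> ('f \<Rightarrow> 'a list \<Rightarrow> 'a) \<Rightarrow> ('a \<Rightarrow> 'a \<Rightarrow> bool) \<Rightarrow> ('f \<Rightarrow> 'f \<Rightarrow> bool)
    \<Rightarrow> ('f, 'v) trm \<Rightarrow> ('f, 'v) trm \<Rightarrow> bool"
  for A :: "'a set" and I :: "'f \<Rightarrow> 'a list \<Rightarrow> 'a" and gt :: "'a \<Rightarrow> 'a \<Rightarrow> bool"
    and prec :: "'f \<Rightarrow> 'f \<Rightarrow> bool" where
  "gt_alg A I gt (Fun f ss) (Fun g ts) \<or> (ge_alg A I gt (Fun f ss) (Fun g ts) \<and> strict_part prec f g)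
    \<Longrightarrow> root_gt A I gt prec (Fun f ss) (Fun g ts)"

inductive spo ::
  "'a set \<Rightarrow> ('f \<Rightarrow> 'a list \<Rightarrow> 'a) \<Rightarrow> ('a \<Rightarrow> 'a \<Rightarrow> bool) \<Rightarrow> ('f \<Rightarrow> 'f \<Rightarrow> bool)
    \<Rightarrow> ('f, 'v) trm \<Rightarrow> ('f, 'v) trm \<Rightarrow> bool"
  for A :: "'a set" and I :: "'f \<Rightarrow> 'a list \<Rightarrow> 'a" and gt :: "'a \<Rightarrow> 'a \<Rightarrow> bool"
    and prec :: "'f \<Rightarrow> 'f \<Rightarrow> bool" where
  arg: "si \<in> set ss \<Longrightarrow> si = t \<or> spo A I gt prec si t \<Longrightarrow> spo A I gt prec (Fun f ss) t"
| root: "(\<And>tj. tj \<in> set ts \<Longrightarrow> spo A I gt prec (Fun f ss) tj)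
    \<Longrightarrow> root_gt A I gt prec (Fun f ss) (Fun g ts)
    \<Longrightarrow> spo A I gt prec (Fun f ss) (Fun g ts)"
| lex: "(\<And>tj. tj \<in> set ts \<Longrightarrow> spo A I gt prec (Fun f ss) tj)
    \<Longrightarrow> root_ge A I gt prec (Fun f ss) (Fun g ts) \<Longrightarrow> lex_ext (spo A I gt prec) ss ts
    \<Longrightarrow> spo A I gt prec (Fun f ss) (Fun g ts)"

definition mspo ::
  "'a set \<Rightarrow> ('f \<Rightarrow> 'a list \<Rightarrow> 'a) \<Rightarrow> ('a \<Rightarrow> 'a \<Rightarrow> bool) \<Rightarrow> ('f \<Rightarrow> 'f \<Rightarrow> bool)
    \<Rightarrow> ('f, 'v) trm \<Rightarrow> ('f, 'v) trm \<Rightarrow> bool" where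
  "mspo A I gt prec s t \<longleftrightarrow> ge_alg A I gt s t \<and> spo A I gt prec s t"

text \<open>
  The path orders above are defined on all elements of the datatype; as they only refer to
  subterms, their restrictions to well-formed terms are the path orders on \<open>T(F, V)\<close>.
\<close>

definition rel_on_terms ::
  "'f set \<Rightarrow> ('f \<Rightarrow> nat) \<Rightarrow> (('f, 'v) trm \<Rightarrow> ('f, 'v) trm \<Rightarrow> bool) \<Rightarrow> ('f, 'v) trm rel" where
  "rel_on_terms F ar R = {(s, t). s \<in> terms_over F ar \<and> t \<in> terms_over F ar \<and> R s t}"

end

theory Submission
  imports Defs
begin

text \<open>
  Simplicity alone makes \<open>spo\<close> contained in \<open>ge_alg\<close>, which gives \<open>spo = mspo \<subseteq> wpo\<close>. For the
  converse only the case \<open>gt_alg\<close> of \<open>wpo\<close> is at issue. Then \<open>s\<close> is not a variable, since a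
  variable can be assigned a minimal element of \<open>A\<close>. If \<open>t\<close> is a variable, it occurs in \<open>s\<close>:
  otherwise it could be assigned the value of \<open>s\<close>. If \<open>t\<close> is not a variable, simplicity yields
  \<open>gt_alg\<close> between \<open>s\<close> and the arguments of \<open>t\<close>, and the claim follows by induction on \<open>t\<close>.
\<close>

text \<open>Induction hypotheses about the path orders hold only for well-formed terms, so the
  global rule \<open>lex_ext_mono\<close> does not suffice: here \<open>R\<close> has to imply
  \<open>S\<close> only between members of the two lists.\<close>

lemma lex_ext_mono_on:
  assumes "lex_ext R ss ts" and "\<And>x y. x \<in> set ss \<Longrightarrow> y \<in> set ts \<Longrightarrow> R x y \<Longrightarrow> S x y"
  shows "lex_ext S ss ts"
  using assms(1) unfolding lex_ext_def
proof (elim disjE exE conjE)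
  fix k
  assume k: "k < min (length ss) (length ts)" and "\<forall>i<k. ss ! i = ts ! i" and "R (ss ! k) (ts ! k)"
  then show "(\<exists>k<min (length ss) (length ts). (\<forall>i<k. ss ! i = ts ! i) \<and> S (ss ! k) (ts ! k)) \<or>
      length ts < length ss \<and> (\<forall>i<length ts. ss ! i = ts ! i)"
    using assms(2) by auto
qed simp

lemma eval_cong: "(\<And>x. x \<in> set2_trm t \<Longrightarrow> \<alpha> x = \<beta> x) \<Longrightarrow> eval I \<alpha> t = eval I \<beta> t"
  by (induction t) (auto intro!: arg_cong[where f = "I _"] map_cong)

text \<open>Descend from the root of \<open>s\<close> to an occurrence of \<open>x\<close>; each
  step is an application of \<open>spo.arg\<close>, which makes no comparison in the
  algebra.\<close>

lemma spo_occurring_var: "x \<in> set2_trm s \<Longrightarrow> s = Var x \<or> spo A I gt prec s (Var x)"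
  by (induction s) (auto intro: spo.arg)

lemma Fun_in_terms_over_iff:
  "Fun f ts \<in> terms_over F ar \<longleftrightarrow> f \<in> F \<and> length ts = ar f \<and> set ts \<subseteq> terms_over F ar"
  by (auto intro: terms_over.Fun elim: terms_over.cases)

locale simple_ordered_algebra =
  fixes F :: "'f set" and ar :: "'f \<Rightarrow> nat"
    and A :: "'a set" and I :: "'f \<Rightarrow> 'a list \<Rightarrow> 'a" and gt :: "'a \<Rightarrow> 'a \<Rightarrow> bool"
  assumes ordered: "ordered_algebra F ar A I gt"
    and simple: "simple_algebra F ar A I gt"
begin

lemma gt_trans: "gt a b \<Longrightarrow> gt b c \<Longrightarrow> a \<in> A \<Longrightarrow> b \<in> A \<Longrightarrow> c \<in> A \<Longrightarrow> gt a c"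
  using ordered unfolding ordered_algebra_def by (meson transp_onD)

lemma not_gt_refl: "a \<in> A \<Longrightarrow> \<not> gt a a"
  using ordered unfolding ordered_algebra_def by (meson irreflp_onD)

lemma eval_in_carrier:
  assumes "t \<in> terms_over F ar" and "range \<alpha> \<subseteq> A"
  shows "eval I \<alpha> t \<in> A"
  using assms(1)
proof (induction rule: terms_over.induct)
  case (Var x)
  then show ?case using assms(2) by auto
next
  case (Fun f ts)
  then show ?case using ordered unfolding ordered_algebra_def
    by (simp add: image_subset_iff)
qed

lemma ge_alg_arg:
  fixes t :: "('f, 'v) trm"
  assumes "Fun f ts \<in> terms_over F ar" and "t \<in> set ts"
  shows "ge_alg A I gt (Fun f ts) t"
  unfolding ge_alg_def
proof (intro allI impI)
  fix \<alpha> :: "'v \<Rightarrow> 'a" assume \<alpha>: "range \<alpha> \<subseteq> A"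
  from assms(2) obtain i where i: "i < length ts" "t = ts ! i" by (metis in_set_conv_nth)
  have f: "f \<in> F" "length ts = ar f" "set (map (eval I \<alpha>) ts) \<subseteq> A"
    using assms(1) eval_in_carrier[OF _ \<alpha>] by (auto simp: Fun_in_terms_over_iff)
  then have "gt\<^sup>=\<^sup>= (I f (map (eval I \<alpha>) ts)) (map (eval I \<alpha>) ts ! i)"
    using simple i(1) unfolding simple_algebra_def by (metis length_map)
  then show "gt\<^sup>=\<^sup>= (eval I \<alpha> (Fun f ts)) (eval I \<alpha> t)" using i by simp
qed

text \<open>Well-formedness keeps all values in the carrier, the only place where \<open>gt\<close>
  is known to be transitive.\<close>

lemma ge_alg_trans:
  fixes s t u :: "('f, 'v) trm"
  assumes "{s, t, u} \<subseteq> terms_over F ar" and "ge_alg A I gt s t" and "ge_alg A I gt t u"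
  shows "ge_alg A I gt s u"
  unfolding ge_alg_def
proof (intro allI impI)
  fix \<alpha> :: "'v \<Rightarrow> 'a" assume \<alpha>: "range \<alpha> \<subseteq> A"
  then have "eval I \<alpha> s \<in> A" "eval I \<alpha> t \<in> A" "eval I \<alpha> u \<in> A"
    using assms(1) by (auto intro: eval_in_carrier)
  moreover have "gt\<^sup>=\<^sup>= (eval I \<alpha> s) (eval I \<alpha> t)" "gt\<^sup>=\<^sup>= (eval I \<alpha> t) (eval I \<alpha> u)"
    using assms(2,3) \<alpha> unfolding ge_alg_def by simp_all
  ultimately show "gt\<^sup>=\<^sup>= (eval I \<alpha> s) (eval I \<alpha> u)" by (auto intro: gt_trans)
qed

lemma gt_ge_alg_trans:
  fixes s t u :: "('f, 'v) trm"
  assumes "{s, t, u} \<subseteq> terms_over F ar" and "gt_alg A I gt s t" and "ge_alg A I gt t u"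
  shows "gt_alg A I gt s u"
  unfolding gt_alg_def
proof (intro allI impI)
  fix \<alpha> :: "'v \<Rightarrow> 'a" assume \<alpha>: "range \<alpha> \<subseteq> A"
  then have "eval I \<alpha> s \<in> A" "eval I \<alpha> t \<in> A" "eval I \<alpha> u \<in> A"
    using assms(1) by (auto intro: eval_in_carrier)
  moreover have "gt (eval I \<alpha> s) (eval I \<alpha> t)" "gt\<^sup>=\<^sup>= (eval I \<alpha> t) (eval I \<alpha> u)"
    using assms(2,3) \<alpha> unfolding ge_alg_def gt_alg_def by simp_all
  ultimately show "gt (eval I \<alpha> s) (eval I \<alpha> u)" by (auto intro: gt_trans)
qed

lemma gt_alg_imp_ge_alg: "gt_alg A I gt s t \<Longrightarrow> ge_alg A I gt s t"
  by (auto simp: gt_alg_def ge_alg_def)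

text \<open>Both rules that compare roots already contain a comparison in the algebra. For
  \<open>spo.arg\<close>, simplicity puts \<open>Fun f ss\<close> weakly above \<open>si\<close>,
  and transitivity does the rest.\<close>

lemma spo_imp_ge_alg:
  assumes "spo A I gt prec s t" and "s \<in> terms_over F ar" and "t \<in> terms_over F ar"
  shows "ge_alg A I gt s t"
  using assms
proof (induction rule: spo.induct)
  case (arg si ss t f)
  then have "si \<in> terms_over F ar" by (auto simp: Fun_in_terms_over_iff)
  with arg show ?case by (metis empty_subsetI ge_alg_arg ge_alg_trans insert_subset)
qed (auto elim!: root_gt.cases root_ge.cases intro: gt_alg_imp_ge_alg)

lemma spo_imp_wpo:
  assumes "spo A I gt prec s t" and "s \<in> terms_over F ar" and "t \<in> terms_over F ar"
  shows "wpo A I gt prec s t"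
  using assms
proof (induction rule: spo.induct)
  case (arg si ss t f)
  \<comment> \<open>Unlike \<open>spo.arg\<close>, the rule \<open>wpo.arg\<close> asks for
    \<open>ge_alg\<close> on the whole pair, so the \<open>spo\<close> step is rebuilt to obtain
    it.\<close>
  have "spo A I gt prec (Fun f ss) t" using arg.hyps arg.IH by (auto intro: spo.arg)
  then have "ge_alg A I gt (Fun f ss) t" using spo_imp_ge_alg arg.prems by blast
  moreover have "si = t \<or> wpo A I gt prec si t"
    using arg by (auto simp: Fun_in_terms_over_iff)
  ultimately show ?case using arg.hyps by (auto intro: wpo.arg)
next
  case (root ts f ss g)
  then have "wpo A I gt prec (Fun f ss) tj" if "tj \<in> set ts" for tj
    using that by (auto simp: Fun_in_terms_over_iff)
  \<comment> \<open>A strict comparison in the algebra is covered by \<open>wpo.alg\<close>, a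
    strict precedence step by \<open>wpo.prec\<close>.\<close>
  with root.hyps(2) show ?case by (auto elim!: root_gt.cases intro: wpo.alg wpo.prec)
next
  case (lex ts f ss g)
  then have "wpo A I gt prec (Fun f ss) tj" if "tj \<in> set ts" for tj
    using that by (auto simp: Fun_in_terms_over_iff)
  moreover have "lex_ext (wpo A I gt prec) ss ts"
    by (rule lex_ext_mono_on[OF lex.IH(2)]) (use lex.prems in \<open>auto simp: Fun_in_terms_over_iff\<close>)
  ultimately show ?case using lex.hyps by (auto elim!: root_ge.cases intro: wpo.alg wpo.lex)
qed

lemma gt_alg_Var_imp_occurs:
  assumes "s \<in> terms_over F ar" and "gt_alg A I gt s (Var y)"
  shows "y \<in> set2_trm s"
proof (rule ccontr)
  assume y: "y \<notin> set2_trm s"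
  obtain a where "a \<in> A" using ordered unfolding ordered_algebra_def by blast
  then have a: "range (\<lambda>_. a) \<subseteq> A" by auto
  define b where "b = eval I (\<lambda>_. a) s"
  have b: "b \<in> A" using eval_in_carrier[OF assms(1) a] by (simp add: b_def)
  \<comment> \<open>Since \<open>y\<close> does not occur in \<open>s\<close>, the update leaves the
    value \<open>b\<close> of \<open>s\<close> unchanged, and the assumption becomes
    \<open>gt b b\<close>.\<close>
  define \<beta> where "\<beta> = (\<lambda>_. a)(y := b)"
  have "range \<beta> \<subseteq> A" using b \<open>a \<in> A\<close> by (auto simp: \<beta>_def)
  then have "gt (eval I \<beta> s) (\<beta> y)" using assms(2) unfolding gt_alg_def by force
  moreover have "eval I \<beta> s = b"
    unfolding b_def by (rule eval_cong) (use y in \<open>auto simp: \<beta>_def\<close>)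
  ultimately show False using not_gt_refl[OF b] by (simp add: \<beta>_def)
qed

end

locale simple_well_founded_algebra = simple_ordered_algebra +
  assumes well_founded: "well_founded_algebra A gt"
begin

lemma not_gt_alg_Var:
  assumes "t \<in> terms_over F ar"
  shows "\<not> gt_alg A I gt (Var x) t"
proof
  assume gt: "gt_alg A I gt (Var x) t"
  have "A \<noteq> {}" using ordered unfolding ordered_algebra_def by blast
  then obtain m where m: "m \<in> A" "\<forall>a\<in>A. \<not> gt m a"
    using well_founded unfolding well_founded_algebra_def wfp_on_iff_ex_minimal
    by (metis conversep_iff order_refl)
  \<comment> \<open>Under this constant assignment \<open>Var x\<close> has the minimal value
    \<open>m\<close>, while the value of \<open>t\<close> is in \<open>A\<close> and so cannot lie
    below it.\<close>
  then have "range (\<lambda>_. m) \<subseteq> A" by auto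
  with gt eval_in_carrier[OF assms this] m show False by (auto simp: gt_alg_def)
qed

lemma gt_alg_imp_spo:
  assumes "t \<in> terms_over F ar" and "gt_alg A I gt s t" and "s \<in> terms_over F ar"
  shows "spo A I gt prec s t"
  using assms
proof (induction rule: terms_over.induct)
  case (Var y)
  have "y \<in> set2_trm s" by (rule gt_alg_Var_imp_occurs) (use Var in auto)
  moreover have "s \<noteq> Var y" using Var.prems(1) by (auto simp: not_gt_alg_Var[OF terms_over.Var])
  ultimately show ?case using spo_occurring_var by metis
next
  case (Fun g ts)
  then have t: "Fun g ts \<in> terms_over F ar" by (auto intro: terms_over.Fun)
  then obtain f ss where s: "s = Fun f ss" using Fun.prems by (cases s) (auto simp: not_gt_alg_Var)
  have "spo A I gt prec s tj" if "tj \<in> set ts" for tj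
  proof (rule Fun.IH[OF that])
    \<comment> \<open>Simplicity gives that \<open>Fun g ts\<close> is weakly above
      \<open>tj\<close>, so the strict comparison with \<open>s\<close> passes down to the
      arguments.\<close>
    show "gt_alg A I gt s tj"
      by (rule gt_ge_alg_trans[OF _ _ ge_alg_arg[OF t that]]) (use Fun that t in auto)
  qed (rule Fun.prems)
  then show ?case using Fun.prems unfolding s by (auto intro: spo.root root_gt.intros)
qed

text \<open>Apart from \<open>alg\<close>, each rule of \<open>wpo\<close> has a counterpart in
  \<open>spo\<close>: \<open>arg\<close> just drops its \<open>ge_alg\<close> premise, while
  \<open>prec\<close> and \<open>lex\<close> pass theirs on to \<open>root_gt\<close> and
  \<open>root_ge\<close>.\<close>

lemma wpo_imp_spo:
  assumes "wpo A I gt prec s t" and "s \<in> terms_over F ar" and "t \<in> terms_over F ar"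
  shows "spo A I gt prec s t"
  using assms
proof (induction rule: wpo.induct)
  case (alg s t)
  then show ?case by (blast intro: gt_alg_imp_spo)
next
  case (arg f ss t si)
  then have "si = t \<or> spo A I gt prec si t" by (auto simp: Fun_in_terms_over_iff)
  with arg.hyps show ?case by (auto intro: spo.arg)
next
  case (prec f ss g ts)
  then have "spo A I gt prec (Fun f ss) tj" if "tj \<in> set ts" for tj
    using that by (auto simp: Fun_in_terms_over_iff)
  with prec.hyps show ?case by (auto intro: spo.root root_gt.intros)
next
  case (lex f ss g ts)
  then have "spo A I gt prec (Fun f ss) tj" if "tj \<in> set ts" for tj
    using that by (auto simp: Fun_in_terms_over_iff)
  moreover have "lex_ext (spo A I gt prec) ss ts"
    by (rule lex_ext_mono_on[OF lex.IH(2)]) (use lex.prems in \<open>auto simp: Fun_in_terms_over_iff\<close>)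
  ultimately show ?case using lex.hyps by (auto intro: spo.lex root_ge.intros)
qed

end

theorem theorem11:
  fixes F :: "'f set" and ar :: "'f \<Rightarrow> nat"
    and A :: "'a set" and I :: "'f \<Rightarrow> 'a list \<Rightarrow> 'a" and gt :: "'a \<Rightarrow> 'a \<Rightarrow> bool"
    and prec :: "'f \<Rightarrow> 'f \<Rightarrow> bool"
  assumes "finite F"
    and "ordered_algebra F ar A I gt"
    and "weakly_monotone_algebra F ar A I gt"
    and "well_founded_algebra A gt"
    and "simple_algebra F ar A I gt"
    and "precedence_on F prec"
  shows "rel_on_terms F ar (wpo A I gt prec :: ('f, 'v) trm \<Rightarrow> ('f, 'v) trm \<Rightarrow> bool)
           = rel_on_terms F ar (spo A I gt prec)
       \<and> rel_on_terms F ar (spo A I gt prec :: ('f, 'v) trm \<Rightarrow> ('f, 'v) trm \<Rightarrow> bool)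
           = rel_on_terms F ar (mspo A I gt prec)"
proof -
  interpret simple_well_founded_algebra F ar A I gt
    using assms by unfold_locales
  show ?thesis
    unfolding rel_on_terms_def mspo_def
    by (auto intro: wpo_imp_spo spo_imp_wpo spo_imp_ge_alg)
qed

end
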